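(* Let $N,\mu$ be integers with $1\le N<\mu$ and let $n\ge0$ be an integer. Then \[ \sum_{p = 1}^n ( - 1)^{p - 1} \sum_{\nu = 1}^N \frac{\mu }{\nu ^{n - p + 1} (\mu - \nu )^p } =H_{N,n} - ( - 1)^n \left[ H_{\mu - 1,n} - H_{\mu - N - 1,n} \right]. \] In particular, \[ \sum_{\nu = 1}^N \frac{\mu }{\nu (\mu - \nu )} = H_N + H_{\mu - 1} - H_{\mu - N - 1}. \]
   Context: For integers $m\ge0$ and $n$, $H_{m,n}=\sum_{k=1}^m k^{-n}$ (with $H_{0,n}=0$), and $H_m=H_{m,1}$. *)

theory Defs
  imports "HOL-Analysis.Harmonic_Numbers"
begin

text \<open>
  Generalized harmonic numbers \<open>H_{m,n}\<close>. The order \<open>n\<close> may be any integer, so the integer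
  power \<open>powi\<close> is used; in particular \<open>H_{m,0} = m\<close>. The ordinary harmonic number
  \<open>H_m = H_{m,1}\<close> is the library constant \<^const>\<open>harm\<close>, see \<open>gen_harm_1\<close> below.
\<close>

definition gen_harm :: "nat \<Rightarrow> int \<Rightarrow> real" where
  "gen_harm m n = (\<Sum>k=1..m. real k powi (- n))"

lemma gen_harm_1: "gen_harm m 1 = harm m"
  by (simp add: gen_harm_def harm_def power_int_minus)

end

theory Submission
  imports Defs
begin

text \<open>
  With \<open>a = 1/\<nu>\<close> and \<open>b = 1/(\<mu> - \<nu>)\<close> one has \<open>\<mu> a b = a + b\<close>, so for fixed \<open>\<nu>\<close> the sum over \<open>p\<close>
  is \<open>a - (-b)\<close> times a geometric sum, namely \<open>a^n - (-b)^n\<close>. Summing over \<open>\<nu>\<close> and reflecting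
  \<open>\<nu> \<mapsto> \<mu> - \<nu>\<close> in the second part gives the harmonic numbers; the second identity is \<open>n = 1\<close>.
\<close>

lemma alternating_partial_fractions:
  fixes x y :: "'a::field"
  assumes "x \<noteq> 0" "y \<noteq> 0"
  shows "(\<Sum>p=1..n. (-1) ^ (p - 1) * ((x + y) / (x ^ (n - p + 1) * y ^ p)))
         = (1 / x) ^ n - (-1) ^ n * (1 / y) ^ n"
proof -
  have "(\<Sum>p=1..n. (-1) ^ (p - 1) * ((x + y) / (x ^ (n - p + 1) * y ^ p)))
      = (\<Sum>i<n. (-1) ^ i * ((x + y) / (x ^ (n - Suc i + 1) * y ^ Suc i)))"
    by (simp add: sum.atLeast1_atMost_eq)
  also have "\<dots> = (\<Sum>i<n. (1 / x + 1 / y) * ((1 / x) ^ (n - Suc i) * (- (1 / y)) ^ i))"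
  proof (rule sum.cong)
    fix i
    \<comment> \<open>One factor \<open>x * y\<close> of the denominator absorbs
      \<open>x + y\<close>; the sign goes into the base \<open>- (1 / y)\<close>.\<close>
    have "(x + y) / (x * y) = 1 / x + 1 / y"
      using assms by (simp add: field_simps)
    then show "(-1) ^ i * ((x + y) / (x ^ (n - Suc i + 1) * y ^ Suc i))
        = (1 / x + 1 / y) * ((1 / x) ^ (n - Suc i) * (- (1 / y)) ^ i)"
      using assms by (simp add: power_minus[of "1 / y"] power_divide field_simps)
  qed simp
  \<comment> \<open>\<open>power_diff_sumr2\<close> carries the factor
    \<open>- (1 / y) - 1 / x\<close>, hence the outer minus sign.\<close>
  also have "\<dots> = - ((- (1 / y)) ^ n - (1 / x) ^ n)"
    unfolding power_diff_sumr2 sum_distrib_left[symmetric] by (simp add: algebra_simps)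
  also have "\<dots> = (1 / x) ^ n - (-1) ^ n * (1 / y) ^ n"
    by (simp add: power_minus[of "1 / y"])
  finally show ?thesis .
qed

lemma gen_harm_of_nat: "gen_harm m (int n) = (\<Sum>k=1..m. (1 / real k) ^ n)"
  by (simp add: gen_harm_def power_int_minus power_one_over inverse_eq_divide)

text \<open>The difference keeps the indices from \<open>\<mu> - N\<close> to
  \<open>\<mu> - 1\<close>; raising \<open>N\<close> by one adds the index
  \<open>\<mu> - Suc N\<close> at the bottom.\<close>

lemma gen_harm_diff_reflected:
  assumes "N < \<mu>"
  shows "gen_harm (\<mu> - 1) (int n) - gen_harm (\<mu> - N - 1) (int n)
         = (\<Sum>\<nu>=1..N. (1 / (real \<mu> - real \<nu>)) ^ n)"
  using assms
proof (induction N)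
  case (Suc N)
  \<comment> \<open>\<open>Suc N < \<mu>\<close> keeps the truncated subtraction exact.\<close>
  have "\<mu> - N - 1 = Suc (\<mu> - Suc N - 1)"
    using Suc.prems by simp
  moreover have "real (Suc (\<mu> - Suc N - 1)) = real \<mu> - real (Suc N)"
    using Suc.prems by (simp add: of_nat_diff)
  ultimately have "gen_harm (\<mu> - N - 1) (int n)
      = gen_harm (\<mu> - Suc N - 1) (int n) + (1 / (real \<mu> - real (Suc N))) ^ n"
    by (simp add: gen_harm_of_nat algebra_simps)
  with Suc show ?case by simp
qed simp

theorem theorem2p3:
  fixes N \<mu> n :: nat
  assumes "1 \<le> N" and "N < \<mu>"
  shows "((\<Sum>p=1..n. (-1) ^ (p - 1) *
            (\<Sum>\<nu>=1..N. real \<mu> / (real \<nu> ^ (n - p + 1) * (real \<mu> - real \<nu>) ^ p)))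
         = gen_harm N (int n)
           - (-1) ^ n * (gen_harm (\<mu> - 1) (int n) - gen_harm (\<mu> - N - 1) (int n)))
       \<and> ((\<Sum>\<nu>=1..N. real \<mu> / (real \<nu> * (real \<mu> - real \<nu>)))
         = harm N + harm (\<mu> - 1) - harm (\<mu> - N - 1))"
proof -
  have main: "(\<Sum>p=1..n. (-1) ^ (p - 1) *
            (\<Sum>\<nu>=1..N. real \<mu> / (real \<nu> ^ (n - p + 1) * (real \<mu> - real \<nu>) ^ p)))
         = gen_harm N (int n)
           - (-1) ^ n * (gen_harm (\<mu> - 1) (int n) - gen_harm (\<mu> - N - 1) (int n))"
    (is "?lhs n = _") for n
  proof -
    have "?lhs n = (\<Sum>\<nu>=1..N. \<Sum>p=1..n. (-1) ^ (p - 1) *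
            (real \<mu> / (real \<nu> ^ (n - p + 1) * (real \<mu> - real \<nu>) ^ p)))"
      unfolding sum_distrib_left by (rule sum.swap)
    also have "\<dots> = (\<Sum>\<nu>=1..N. (1 / real \<nu>) ^ n - (-1) ^ n * (1 / (real \<mu> - real \<nu>)) ^ n)"
    proof (rule sum.cong)
      fix \<nu> assume "\<nu> \<in> {1..N}"
      then have "real \<nu> \<noteq> 0" "real \<mu> - real \<nu> \<noteq> 0"
        using assms by auto
      \<comment> \<open>Here \<open>x + y\<close> collapses to \<open>\<mu>\<close>.\<close>
      from alternating_partial_fractions[OF this, of n]
      show "(\<Sum>p=1..n. (-1) ^ (p - 1) *
              (real \<mu> / (real \<nu> ^ (n - p + 1) * (real \<mu> - real \<nu>) ^ p)))
          = (1 / real \<nu>) ^ n - (-1) ^ n * (1 / (real \<mu> - real \<nu>)) ^ n"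
        by simp
    qed simp
    also have "\<dots> = gen_harm N (int n)
           - (-1) ^ n * (gen_harm (\<mu> - 1) (int n) - gen_harm (\<mu> - N - 1) (int n))"
      unfolding gen_harm_diff_reflected[OF assms(2)]
      by (simp add: gen_harm_of_nat sum_subtractf sum_distrib_left)
    finally show ?thesis .
  qed
  show ?thesis
    \<comment> \<open>At \<open>n = 1\<close> only \<open>p = 1\<close> remains, and the sign
      \<open>- (-1) ^ 1\<close> becomes plus.\<close>
    using main[of n] main[of 1] by (simp add: gen_harm_1)
qed

end
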